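(* Let $k, m, n$ be positive integers with $m \leqslant n$. Then: (i) $F_k = L_m L_n$ holds if and only if $$(k,m,n) \in \{(1,1,1),\ (2,1,1),\ (4,1,2),\ (8,2,4)\}.$$ (ii) $L_k = F_m F_n$ holds if and only if $$(k,m,n) \in \{(1,1,1),\ (1,1,2),\ (1,2,2),\ (2,1,4),\ (2,2,4),\ (3,3,3)\}.$$
   Context: $(F_n)_{n\geqslant 0}$ is the Fibonacci sequence: $F_0=0$, $F_1=1$, $F_{n+1}=F_n+F_{n-1}$ for $n \geqslant 1$. $(L_n)_{n\geqslant 0}$ is the Lucas sequence: $L_0=2$, $L_1=1$, $L_{n+1}=L_n+L_{n-1}$ for $n\geqslant 1$. *)

theory Defs
  imports "HOL-Number_Theory.Fib"
begin

fun lucas :: "nat \<Rightarrow> nat" where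
  "lucas 0 = 2"
| "lucas (Suc 0) = 1"
| "lucas (Suc (Suc n)) = lucas (Suc n) + lucas n"

end

theory Submission
  imports Defs
begin

text \<open>
  Asymptotically $F_k$, $L_m L_n$, $L_k$, $F_m F_n$ are $\varphi^k/\sqrt 5$, $\varphi^{m+n}$,
  $\varphi^k$, $\varphi^{m+n}/5$, and neither $\sqrt 5$ nor $5$ is a power of $\varphi$. Hence
  the product lies strictly between two consecutive terms of the other sequence, namely
  $F_{m+n+1} < L_m L_n < F_{m+n+2}$ and $L_{m+n-4} < F_m F_n < L_{m+n-3}$, apart from some
  cases with small $m$. The addition formula turns each inequality into one between bilinear
  forms in $(F_p, F_{p+1})$ and $(F_q, F_{q+1})$, where $p$ and $q$ are shifts of $m$ and $n$.
\<close>

lemma lucas_Suc_conv_fib: "lucas (Suc n) = fib n + fib (Suc (Suc n))"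
  by (induction n rule: fib.induct) auto

lemma fib_less_imp_less: "fib j < fib k \<Longrightarrow> j < k"
  by (meson fib_mono leD leI)

text \<open>The tool for excluding solutions. It needs only weak monotonicity of \<open>fib\<close>,
  so the coincidence F_1 = F_2 does no harm.\<close>

lemma fib_neq_if_between:
  assumes "fib j < x" and "x < fib (Suc j)"
  shows "fib k \<noteq> x"
  using assms fib_less_imp_less[of j k] fib_less_imp_less[of k "Suc j"] by auto

lemma fib_eq_fib_iff:
  assumes "2 \<le> j"
  shows "fib k = fib j \<longleftrightarrow> k = j \<or> (j = 2 \<and> k = 1)"
proof
  assume eq: "fib k = fib j"
  obtain i where j: "j = Suc (Suc i)"
    using assms that[of "j - 2"] by simp
  have "fib j < fib (Suc j)"
    by (simp add: j fib_neq_0_nat)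
  then have "k \<le> j"
    using eq fib_less_imp_less[of k "Suc j"] by simp
  \<comment> \<open>The bound on k from below comes from F_{j-1} < F_j, which fails at j =
    2.\<close>
  show "k = j \<or> (j = 2 \<and> k = 1)"
  proof (cases i)
    case 0
    with eq \<open>k \<le> j\<close> j show ?thesis by (cases k) (auto simp: le_Suc_eq)
  next
    case (Suc l)
    then have "fib (Suc i) < fib j"
      by (simp add: j fib_neq_0_nat)
    then have "Suc i < k"
      using eq fib_less_imp_less[of "Suc i" k] by simp
    with \<open>k \<le> j\<close> j show ?thesis by simp
  qed
qed auto

text \<open>Index 0 is exceptional: L_0 = 2 exceeds L_1 = 1, hence the positive indices from here
  on.\<close>

lemma lucas_less_lucas_Suc: "0 < n \<Longrightarrow> lucas n < lucas (Suc n)"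
  by (induction n rule: lucas.induct) (auto simp: lucas_Suc_conv_fib fib_neq_0_nat)

lemma lucas_strict_mono: "0 < m \<Longrightarrow> m < n \<Longrightarrow> lucas m < lucas n"
  by (induction n) (auto simp: less_Suc_eq intro: lucas_less_lucas_Suc order.strict_trans)

lemma lucas_neq_if_between:
  assumes "0 < k" and "0 < j" and "lucas j < x" and "x < lucas (Suc j)"
  shows "lucas k \<noteq> x"
proof -
  have "k \<le> j \<or> k = Suc j \<or> Suc j < k" by auto
  then show ?thesis
    using assms lucas_strict_mono[of k j] lucas_strict_mono[of "Suc j" k]
    by (auto simp: le_less)
qed

text \<open>Settles m = 1 in (i) and, with the roles of the sequences exchanged, m \<le> 2 in (ii).
  For n \<ge> 3, L_n = F_{n+1} + F_{n-1} with 0 < F_{n-1} < F_n, so L_n lies strictly between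
  F_{n+1} and F_{n+2}.\<close>

lemma fib_eq_lucas_iff:
  assumes "0 < k" and "0 < n"
  shows "fib k = lucas n \<longleftrightarrow> (k, n) \<in> {(1, 1), (2, 1), (4, 2)}"
proof -
  consider "n = 1" | "n = 2" | q where "n = Suc (Suc (Suc q))"
    using assms(2) that(3)[of "n - 3"] by fastforce
  then show ?thesis
  proof cases
    case 1
    then show ?thesis using fib_eq_fib_iff[of 2 k] by auto
  next
    case 2
    then show ?thesis using fib_eq_fib_iff[of 4 k]
      by (auto simp: numeral_eq_Suc)
  next
    case 3
    have "fib k \<noteq> lucas n"
      by (rule fib_neq_if_between[of "Suc n"])
        (use fib_Suc_mono[of q] in \<open>auto simp: 3 lucas_Suc_conv_fib fib_neq_0_nat\<close>)
    then show ?thesis using 3 by auto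
  qed
qed

text \<open>The case m = 2 of (i), as L_2 = 3. For n \<ge> 4, F_{n+4} - 3 L_n = F_{n-4}: this
  vanishes at n = 4, giving the solution, and is positive from n = 5 on, where also F_{n+3} < 3
  L_n.\<close>

lemma fib_eq_three_mult_lucas_iff:
  assumes "2 \<le> n"
  shows "fib k = 3 * lucas n \<longleftrightarrow> k = 8 \<and> n = 4"
proof -
  consider "n = 2" | "n = 3" | "n = 4" | q where "n = q + 5"
    using assms that(4)[of "n - 5"] by fastforce
  then show ?thesis
  proof cases
    case 1
    have "fib k \<noteq> 9" by (rule fib_neq_if_between[of 6]) (simp_all add: numeral_eq_Suc)
    with 1 show ?thesis by (simp add: numeral_eq_Suc)
  next
    case 2
    have "fib k \<noteq> 12" by (rule fib_neq_if_between[of 6]) (simp_all add: numeral_eq_Suc)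
    with 2 show ?thesis by (simp add: numeral_eq_Suc)
  next
    case 3
    then show ?thesis using fib_eq_fib_iff[of 8 k] by (simp add: numeral_eq_Suc)
  next
    case 4
    have "fib k \<noteq> 3 * lucas n"
      by (rule fib_neq_if_between[of "n + 3"])
        (use fib_Suc_mono[of q] in
          \<open>auto simp: 4 lucas_Suc_conv_fib fib_neq_0_nat numeral_eq_Suc\<close>)
    with 4 show ?thesis by simp
  qed
qed

lemma fib_add_Suc: "fib (Suc (p + q)) = fib (Suc p) * fib (Suc q) + fib p * fib q"
  using fib_add[of q p] by (simp add: add.commute mult.commute)

text \<open>F_{p+2} is expanded so that only F_p, F_{p+1}, F_q, F_{q+1} occur.\<close>

lemma fib_add_Suc_Suc:
  "fib (Suc (Suc (p + q))) = (fib p + fib (Suc p)) * fib (Suc q) + fib (Suc p) * fib q"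
  using fib_add_Suc[of "Suc p" q] by (simp add: add.commute)

lemma fib_neq_lucas_mult_lucas:
  assumes "3 \<le> m" and "3 \<le> n"
  shows "fib k \<noteq> lucas m * lucas n"
proof -
  obtain p q where m: "m = p + 3" and n: "n = q + 3"
    using assms that[of "m - 3" "n - 3"] by simp
  define a b c d where "a = fib p" "b = fib (Suc p)" "c = fib q" "d = fib (Suc q)"
  note abcd = this
  have "a \<le> b" "0 < b" "c \<le> d" "0 < d"
    by (simp_all add: abcd fib_Suc_mono fib_neq_0_nat)
  \<comment> \<open>The differences to the bounds F_{m+n+1} and F_{m+n+2} are 4ac + 4ad + 4bc + 3bd
    and ad + bc + 5bd - ac; the only negative term is absorbed by bd.\<close>
  then have le: "a * c \<le> b * d" "0 < b * d"
    by (simp_all add: mult_mono)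
  have prod: "lucas m * lucas n = (3 * a + 4 * b) * (3 * c + 4 * d)"
    by (simp add: m n numeral_eq_Suc lucas_Suc_conv_fib abcd algebra_simps)
  have mn: "m + n = Suc (Suc (Suc (Suc (Suc (Suc (p + q))))))"
    by (simp add: m n)
  note fib_pq = fib_add_Suc_Suc[of p q]
  show ?thesis
  proof (rule fib_neq_if_between)
    show "fib (Suc (m + n)) < lucas m * lucas n"
      using le fib_pq unfolding prod mn fib.simps(3) fib_add_Suc abcd[symmetric]
      by (simp add: algebra_simps del: nat_0_less_mult_iff)
    show "lucas m * lucas n < fib (Suc (Suc (m + n)))"
      using le fib_pq unfolding prod mn fib.simps(3) fib_add_Suc abcd[symmetric]
      by (simp add: algebra_simps del: nat_0_less_mult_iff)
  qed
qed

lemma lucas_neq_fib_mult_fib: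
  assumes "0 < k" and "3 \<le> m" and "m \<le> n" and "3 < n"
  shows "lucas k \<noteq> fib m * fib n"
proof -
  obtain p q where m: "m = p + 3" and n: "n = q + 3" "0 < q"
    using assms that[of "m - 3" "n - 3"] by simp
  define a b c d where "a = fib p" "b = fib (Suc p)" "c = fib q" "d = fib (Suc q)"
  note abcd = this
  have "a \<le> b" "0 < b" "c \<le> d" "0 < c" "0 < d"
    using n by (simp_all add: abcd fib_Suc_mono fib_neq_0_nat)
  \<comment> \<open>The differences to the two bounds are ad + bc + bd - ac and ad + bc. Both are
    positive because bc > 0, which is where n > 3 enters; at m = n = 3 the second one vanishes,
    giving L_3 = 4 = F_3 F_3.\<close>
  then have le: "a * c \<le> b * d" "0 < b * d" "0 < b * c"
    by (simp_all add: mult_mono)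
  have prod: "fib m * fib n = (a + 2 * b) * (c + 2 * d)"
    by (simp add: m n numeral_eq_Suc abcd algebra_simps)
  note fib_pq = fib_add_Suc_Suc[of p q]
  show ?thesis
  proof (rule lucas_neq_if_between[OF assms(1)])
    show "lucas (Suc (Suc (p + q))) < fib m * fib n"
      using le fib_pq unfolding prod lucas_Suc_conv_fib fib.simps(3) fib_add_Suc abcd[symmetric]
      by (simp add: algebra_simps del: nat_0_less_mult_iff)
    show "fib m * fib n < lucas (Suc (Suc (Suc (p + q))))"
      using le fib_pq unfolding prod lucas_Suc_conv_fib fib.simps(3) fib_add_Suc abcd[symmetric]
      by (simp add: algebra_simps del: nat_0_less_mult_iff)
  qed simp
qed

theorem theorem2:
  fixes k m n :: nat
  assumes "k > 0" and "m > 0" and "n > 0" and "m \<le> n"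
  shows "(fib k = lucas m * lucas n \<longleftrightarrow>
           (k, m, n) \<in> {(1, 1, 1), (2, 1, 1), (4, 1, 2), (8, 2, 4)}) \<and>
         (lucas k = fib m * fib n \<longleftrightarrow>
           (k, m, n) \<in> {(1, 1, 1), (1, 1, 2), (1, 2, 2), (2, 1, 4), (2, 2, 4), (3, 3, 3)})"
proof
  consider "m = 1" | "m = 2" | "3 \<le> m"
    using \<open>m > 0\<close> by linarith
  then show "fib k = lucas m * lucas n \<longleftrightarrow>
      (k, m, n) \<in> {(1, 1, 1), (2, 1, 1), (4, 1, 2), (8, 2, 4)}"
  proof cases
    case 1
    then show ?thesis using fib_eq_lucas_iff[of k n] assms by auto
  next
    case 2
    then have "lucas m = 3" by (simp add: numeral_eq_Suc)
    then show ?thesis using fib_eq_three_mult_lucas_iff[of n k] assms 2 by simp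
  next
    case 3
    then show ?thesis using fib_neq_lucas_mult_lucas[of m n k] assms by auto
  qed
next
  consider "m = 1 \<or> m = 2" | "m = 3" "n = 3" | "3 \<le> m" "3 < n"
    using \<open>m > 0\<close> \<open>m \<le> n\<close> by linarith
  then show "lucas k = fib m * fib n \<longleftrightarrow>
      (k, m, n) \<in> {(1, 1, 1), (1, 1, 2), (1, 2, 2), (2, 1, 4), (2, 2, 4), (3, 3, 3)}"
  proof cases
    case 1
    then have "fib m = 1" by auto
    \<comment> \<open>As F_1 = F_2 = 1, the equation reads F_n = L_k, and each of its solutions
      serves both values of m allowed by m \<le> n.\<close>
    then have "lucas k = fib m * fib n \<longleftrightarrow> (n, k) \<in> {(1, 1), (2, 1), (4, 2)}"
      using fib_eq_lucas_iff[of n k] assms by auto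
    then show ?thesis using 1 assms by auto
  next
    case 2
    have "lucas 3 = 4" by (simp add: numeral_eq_Suc)
    then have "lucas k = 4 \<longleftrightarrow> k = 3"
      using lucas_strict_mono[of k 3] lucas_strict_mono[of 3 k] assms
      by (cases k "3 :: nat" rule: linorder_cases) auto
    then show ?thesis using 2 by (simp add: numeral_eq_Suc)
  next
    case 3
    then show ?thesis using lucas_neq_fib_mult_fib[of k m n] assms by auto
  qed
qed

end
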